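(* Let $d=(d_1,\ldots,d_n)$ be a non-increasing graphic sequence with $d_n\geq 1$. If $\gamma_{\min}(d)=k$, then there is a graph $G$ with vertex set $\{u_1,\ldots,u_n\}$ and $d_G(u_i)=d_i$ for every $i\in[n]$ such that (i) $D=\{u_1,\ldots,u_k\}$ and $\bar D=\{u_{k+1},\ldots,u_n\}$ are both dominating sets of $G$, (ii) the sequence $(d_{\bar D}(u_1),\ldots,d_{\bar D}(u_k))$ is non-increasing, and (iii) the sequence $(d_D(u_{k+1}),\ldots,d_D(u_n))$ is non-increasing.
   Context: All graphs are finite, simple and undirected. $[n]=\{1,\ldots,n\}$. $d_G(u)$ is the degree of $u$ in $G$, and for $U\subseteq V(G)$, $d_U(u)$ is the number of neighbors of $u$ in $U$. A sequence $d=(d_1,\ldots,d_n)$ of non-negative integers is non-increasing if $d_1\ge\cdots\ge d_n$, and graphic if it is the degree sequence of some graph; such a graph is a realization of $d$. $\mathcal{G}(d)$ is the set of all realizations of $d$. A set $D\subseteq V(G)$ is a dominating set of $G$ if every vertex in $V(G)\setminus D$ has a neighbor in $D$; $\gamma(G)$ is the minimum order of a dominating set of $G$. $\gamma_{\min}(d)=\min\{\gamma(G):G\in\mathcal{G}(d)\}$. *)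

theory Defs
  imports "Graph_Theory.Graph_Theory"
begin

text \<open>
  Finite simple undirected graphs are the finite, loop-free symmetric digraphs of
  \<^locale>\<open>pair_graph\<close>: an edge uv is the pair of arcs (u, v) and (v, u), so that the
  out-degree of a vertex is its degree in the undirected graph.
\<close>

abbreviation degree :: "'a pair_pre_digraph \<Rightarrow> 'a \<Rightarrow> nat" where
  "degree G v \<equiv> out_degree (with_proj G) v"

definition degree_in :: "'a pair_pre_digraph \<Rightarrow> 'a set \<Rightarrow> 'a \<Rightarrow> nat" where
  "degree_in G U v = card {w \<in> U. (v, w) \<in> parcs G}"

definition dominating_set :: "'a pair_pre_digraph \<Rightarrow> 'a set \<Rightarrow> bool" where
  "dominating_set G D \<longleftrightarrow>
     D \<subseteq> pverts G \<and> (\<forall>v \<in> pverts G - D. \<exists>w \<in> D. (v, w) \<in> parcs G)"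

definition domination_number :: "'a pair_pre_digraph \<Rightarrow> nat" where
  "domination_number G = (LEAST m. \<exists>D. dominating_set G D \<and> card D = m)"

text \<open>
  A sequence of length n is a function on the naturals, of which only the values at
  1, ..., n matter.
\<close>

definition realization_by ::
    "nat \<Rightarrow> (nat \<Rightarrow> nat) \<Rightarrow> 'a pair_pre_digraph \<Rightarrow> (nat \<Rightarrow> 'a) \<Rightarrow> bool" where
  "realization_by n d G u \<longleftrightarrow>
     pair_graph G \<and> bij_betw u {1..n} (pverts G) \<and> (\<forall>i \<in> {1..n}. degree G (u i) = d i)"

text \<open>
  Since every finite graph is isomorphic to one whose vertices are natural numbers,
  it suffices to collect the realizations of this kind.
\<close>

definition realizations :: "nat \<Rightarrow> (nat \<Rightarrow> nat) \<Rightarrow> nat pair_pre_digraph set" where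
  "realizations n d = {G. \<exists>u. realization_by n d G u}"

definition graphic :: "nat \<Rightarrow> (nat \<Rightarrow> nat) \<Rightarrow> bool" where
  "graphic n d \<longleftrightarrow> realizations n d \<noteq> {}"

definition gamma_min :: "nat \<Rightarrow> (nat \<Rightarrow> nat) \<Rightarrow> nat" where
  "gamma_min n d = (LEAST m. \<exists>G \<in> realizations n d. domination_number G = m)"

end

theory Submission
  imports Defs
begin

text \<open>
  Both parts are extremal arguments with degree-preserving edge switches. First, among all
  realizations with a dominating set D of k vertices choose one minimizing the sum of the
  indices in D; if D were not an initial segment, some vertex of D could be exchanged for one
  of smaller index outside D. Secondly, among the realizations dominated by 1, ..., k choose
  one minimizing the sum of a + b over the edges ab between D and its complement. If i < j lie
  on the same side and j has more neighbors across than i, then i has more neighbors on its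
  own side than j, so the edges jz (across) and it (inside) can be replaced by iz and jt; this
  keeps D dominating and lowers the sum. The complement of D dominates because k is minimal
  and no vertex is isolated.
\<close>

section \<open>Edge relations and degree-preserving switches\<close>

text \<open>The vertex set stays fixed and only the edges vary, so a switch becomes an operation on
  relations.\<close>

definition realizes :: "'a set \<Rightarrow> ('a \<Rightarrow> nat) \<Rightarrow> ('a \<times> 'a) set \<Rightarrow> bool" where
  "realizes V d E \<longleftrightarrow>
     finite V \<and> E \<subseteq> V \<times> V \<and> sym E \<and> irrefl E \<and> (\<forall>v \<in> V. card (E `` {v}) = d v)"

definition dominating :: "'a set \<Rightarrow> ('a \<times> 'a) set \<Rightarrow> 'a set \<Rightarrow> bool" where
  "dominating V E D \<longleftrightarrow> D \<subseteq> V \<and> (\<forall>v \<in> V - D. \<exists>w \<in> D. (v, w) \<in> E)"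

text \<open>
  If every vertex of C is adjacent to exactly one of x and y, toggling all pairs between
  {x, y} and C interchanges these adjacencies. Every switch below has this form.
\<close>

definition toggle :: "'a set \<Rightarrow> 'a set \<Rightarrow> ('a \<times> 'a) set \<Rightarrow> ('a \<times> 'a) set" where
  "toggle X C E = {(a, b). ((a, b) \<in> E) \<noteq> (a \<in> X \<and> b \<in> C \<or> a \<in> C \<and> b \<in> X)}"

lemma in_toggle_iff:
  "(a, b) \<in> toggle X C E \<longleftrightarrow> ((a, b) \<in> E) \<noteq> (a \<in> X \<and> b \<in> C \<or> a \<in> C \<and> b \<in> X)"
  by (simp add: toggle_def)

lemma realizes_finite_nbrs: "realizes V d E \<Longrightarrow> finite (E `` S)"
  unfolding realizes_def by (metis Image_subset finite_subset)

lemma realizes_sym: "realizes V d E \<Longrightarrow> (a, b) \<in> E \<longleftrightarrow> (b, a) \<in> E"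
  unfolding realizes_def by (meson symD)

lemma realizes_irrefl: "realizes V d E \<Longrightarrow> (a, a) \<notin> E"
  unfolding realizes_def by (meson irreflD)

lemma realizes_card: "realizes V d E \<Longrightarrow> v \<in> V \<Longrightarrow> card (E `` {v}) = d v"
  unfolding realizes_def by blast

lemma realizes_verts: "realizes V d E \<Longrightarrow> (a, b) \<in> E \<Longrightarrow> a \<in> V \<and> b \<in> V"
  unfolding realizes_def by blast

text \<open>Toggling by \<open>C\<close> turns a neighborhood \<open>N\<close> into its symmetric
  difference with \<open>C\<close>; as many vertices are gained as lost.\<close>

lemma card_toggle_set:
  assumes "finite N" "finite C" "card (C - N) = card (C \<inter> N)"
  shows "card ((N - C) \<union> (C - N)) = card N"
proof -
  have "card ((N - C) \<union> (C - N)) = card (N - C) + card (C \<inter> N)"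
    using assms by (subst card_Un_disjoint) auto
  also have "\<dots> = card ((N - C) \<union> (C \<inter> N))"
    using assms by (subst card_Un_disjoint) auto
  also have "(N - C) \<union> (C \<inter> N) = N" by blast
  finally show ?thesis .
qed

text \<open>By \<open>xor\<close> each vertex of \<open>C\<close> trades one of \<open>x\<close>,
  \<open>y\<close> for the other; by \<open>card\<close> the vertices \<open>x\<close> and
  \<open>y\<close> lose as many neighbors in \<open>C\<close> as they gain. All other neighborhoods
  are unchanged.\<close>

lemma realizes_toggle:
  assumes E: "realizes V d E"
    and xy: "x \<in> V" "y \<in> V" "x \<noteq> y" "C \<subseteq> V" "x \<notin> C" "y \<notin> C"
    and xor: "\<And>z. z \<in> C \<Longrightarrow> (x, z) \<in> E \<longleftrightarrow> (y, z) \<notin> E"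
    and card: "card (C \<inter> E `` {x}) = card (C \<inter> E `` {y})"
  shows "realizes V d (toggle {x, y} C E)"
proof -
  let ?E = "toggle {x, y} C E"
  note finN = realizes_finite_nbrs[OF E] and symE = realizes_sym[OF E]
  have fin: "finite V" "finite C"
    using E xy finite_subset unfolding realizes_def by blast+
  have nbr_hub: "card (?E `` {v}) = card (E `` {v})" if "v = x \<or> v = y" for v
  proof -
    have "?E `` {v} = (E `` {v} - C) \<union> (C - E `` {v})"
      using that xy by (auto simp: in_toggle_iff)
    moreover have "C - E `` {x} = C \<inter> E `` {y}" "C - E `` {y} = C \<inter> E `` {x}"
      using xor by auto
    ultimately show ?thesis
      using that card card_toggle_set[OF finN[of "{v}"] fin(2)] by auto
  qed
  have nbr_C: "card (?E `` {v}) = card (E `` {v})" if "v \<in> C" for v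
  proof -
    have "?E `` {v} = (E `` {v} - {x, y}) \<union> ({x, y} - E `` {v})"
      using that xy by (auto simp: in_toggle_iff)
    moreover have "card ({x, y} - E `` {v}) = card ({x, y} \<inter> E `` {v})"
    proof (cases "(v, x) \<in> E")
      case True
      then have "{x, y} - E `` {v} = {y}" "{x, y} \<inter> E `` {v} = {x}"
        using xor[OF that] symE xy by auto
      then show ?thesis by simp
    next
      case False
      then have "{x, y} - E `` {v} = {x}" "{x, y} \<inter> E `` {v} = {y}"
        using xor[OF that] symE xy by auto
      then show ?thesis by simp
    qed
    ultimately show ?thesis
      using card_toggle_set[OF finN[of "{v}"]] by simp
  qed
  have "?E `` {v} = E `` {v}" if "v \<notin> C" "v \<noteq> x" "v \<noteq> y" for v
    using that by (auto simp: in_toggle_iff)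
  with nbr_hub nbr_C have "card (?E `` {v}) = d v" if "v \<in> V" for v
    using realizes_card[OF E that] by metis
  moreover have "?E \<subseteq> V \<times> V"
    using xy realizes_verts[OF E] by (auto simp: toggle_def)
  moreover have "sym ?E"
    using symE by (auto intro!: symI simp: in_toggle_iff)
  moreover have "irrefl ?E"
    using realizes_irrefl[OF E] xy by (auto intro!: irreflI simp: in_toggle_iff)
  ultimately show ?thesis using fin by (simp add: realizes_def)
qed

text \<open>The toggle with \<open>C = {z, t}\<close>: \<open>i\<close> and \<open>j\<close> each
  have exactly one neighbor in \<open>C\<close>, and these differ.\<close>

lemma realizes_two_switch:
  assumes E: "realizes V d E"
    and "(i, t) \<in> E" "(j, z) \<in> E" "(i, z) \<notin> E" "(j, t) \<notin> E"
    and "i \<noteq> j" "z \<noteq> i" "t \<noteq> j"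
  shows "realizes V d (toggle {i, j} {z, t} E)"
proof (rule realizes_toggle[OF E])
  have "{z, t} \<inter> E `` {i} = {t}" "{z, t} \<inter> E `` {j} = {z}"
    using assms by auto
  then show "card ({z, t} \<inter> E `` {i}) = card ({z, t} \<inter> E `` {j})" by simp
qed (use assms realizes_verts[OF E] realizes_irrefl[OF E] in auto)

section \<open>Exchanging vertices of the dominating set\<close>

text \<open>
  The private neighbors of y are handed over to x in exchange for equally many neighbors of x.
  The third alternative of the last assumption says that this exchange is not void, so that
  it may be chosen to make y adjacent to the vertex of D that dominated x.
\<close>

lemma dominating_swap:
  assumes E: "realizes V d E" and D: "dominating V E D"
    and xy: "x \<in> V - D" "y \<in> D" "d y \<le> d x"
    and good: "(x, y) \<in> E \<or> (\<exists>c \<in> D. (x, c) \<in> E \<and> (y, c) \<in> E) \<or> E `` {y} - E `` {x} - {x} \<noteq> {}"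
  shows "\<exists>E'. realizes V d E' \<and> dominating V E' (insert x (D - {y}))"
proof -
  note finN = realizes_finite_nbrs[OF E] and symE = realizes_sym[OF E]
    and irrE = realizes_irrefl[OF E]
  define A B where "A = E `` {y} - E `` {x} - {x}" and "B = E `` {x} - E `` {y} - {y}"
  have yV: "y \<in> V" and neq: "x \<noteq> y" using xy D unfolding dominating_def by auto
  obtain w where w: "w \<in> D" "(x, w) \<in> E" using xy D unfolding dominating_def by blast
  have fin: "finite A" "finite B" using finN by (auto simp: A_def B_def)
  \<comment> \<open>Common neighbors and a possible edge between \<open>x\<close> and
    \<open>y\<close> count equally for both vertices, so \<open>d y \<le> d x\<close> passes to the
    private neighbors.\<close>
  have card_le: "card A \<le> card B"
  proof -
    let ?Z = "E `` {x} \<inter> E `` {y}"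
    have "card (E `` {y} - {x}) = card A + card ?Z"
      using finN irrE by (subst card_Un_disjoint[symmetric]) (auto simp: A_def intro!: arg_cong[of _ _ card])
    moreover have "card (E `` {x} - {y}) = card B + card ?Z"
      using finN irrE by (subst card_Un_disjoint[symmetric]) (auto simp: B_def intro!: arg_cong[of _ _ card])
    moreover have "card (E `` {y} - {x}) \<le> card (E `` {x} - {y})"
      using xy yV symE realizes_card[OF E] by (cases "(x, y) \<in> E") (auto simp: card_Diff_singleton_if)
    ultimately show ?thesis by linarith
  qed
  \<comment> \<open>\<open>A'\<close> is the part of \<open>B\<close> handed to \<open>y\<close>. If
    \<open>A\<close> is nonempty and \<open>w\<close> lies in \<open>B\<close>, then
    \<open>w\<close> is chosen first, with \<open>card A - 1\<close> further vertices.\<close>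
  obtain A' where A': "A' \<subseteq> B" "card A' = card A" "A \<noteq> {} \<Longrightarrow> w \<in> B \<Longrightarrow> w \<in> A'"
  proof (cases "A \<noteq> {} \<and> w \<in> B")
    case True
    then have "card A - 1 \<le> card (B - {w})" using card_le fin by simp
    then obtain T where T: "T \<subseteq> B - {w}" "card T = card A - 1" "finite T"
      by (meson obtain_subset_with_card_n)
    moreover have "card A > 0" using True fin by (simp add: card_gt_0_iff)
    ultimately have "card (insert w T) = card A" by (subst card_insert_disjoint) auto
    then show ?thesis using T True that[of "insert w T"] by auto
  next
    case False
    then show ?thesis using obtain_subset_with_card_n[OF card_le] that by metis
  qed
  let ?C = "A \<union> A'" let ?E = "toggle {x, y} ?C E"
  have "?C \<inter> E `` {x} = A'" "?C \<inter> E `` {y} = A"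
    using A' by (auto simp: A_def B_def)
  moreover have "?C \<subseteq> V"
    using A'(1) realizes_verts[OF E] unfolding A_def B_def by blast
  moreover have "x \<notin> ?C" "y \<notin> ?C" "\<And>z. z \<in> ?C \<Longrightarrow> (x, z) \<in> E \<longleftrightarrow> (y, z) \<notin> E"
    using A'(1) irrE by (auto simp: A_def B_def)
  ultimately have real: "realizes V d ?E"
    using A'(2) xy yV neq by (intro realizes_toggle[OF E]) simp_all
  have "\<exists>u \<in> insert x (D - {y}). (v, u) \<in> ?E" if v: "v \<in> V - insert x (D - {y})" for v
  proof (cases "v = y")
    case True
    show ?thesis
    proof (cases "(x, y) \<in> E")
      case True
      then have "(y, x) \<in> ?E" using symE A' by (auto simp: in_toggle_iff A_def B_def irrE)
      then show ?thesis using \<open>v = y\<close> by blast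
    next
      case notadj: False
      show ?thesis
      proof (cases "\<exists>c \<in> D. (x, c) \<in> E \<and> (y, c) \<in> E")
        case True
        then obtain c where c: "c \<in> D" "(x, c) \<in> E" "(y, c) \<in> E" by blast
        then have "(y, c) \<in> ?E" "c \<noteq> y"
          using A' irrE by (auto simp: in_toggle_iff A_def B_def)
        then show ?thesis using c \<open>v = y\<close> by blast
      next
        case False
        \<comment> \<open>With no edge to \<open>x\<close> and no common neighbor in
          \<open>D\<close>, \<open>good\<close> leaves only \<open>A \<noteq> {}\<close>; moreover
          \<open>w\<close> lies in \<open>B\<close>, so it was chosen.\<close>
        then have "w \<in> A'" using A' w good notadj by (auto simp: A_def B_def)
        then have "(y, w) \<in> ?E" "w \<noteq> y"
          using A' by (auto simp: in_toggle_iff A_def B_def)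
        then show ?thesis using w \<open>v = y\<close> by blast
      qed
    qed
  next
    case False
    then obtain u where u: "u \<in> D" "(v, u) \<in> E" using v D unfolding dominating_def by blast
    show ?thesis
    proof (cases "u = y")
      case True
      \<comment> \<open>A neighbor \<open>v\<close> of \<open>y\<close> is adjacent to
        \<open>x\<close> afterwards: by the toggle if \<open>v \<in> A\<close>, and otherwise as a
        common neighbor, which the toggle leaves alone.\<close>
      then have "(v, x) \<in> ?E"
        using u v False A' symE[of v] by (auto simp: in_toggle_iff A_def B_def)
      then show ?thesis by blast
    next
      case False
      then have "(v, u) \<in> ?E"
        using u v \<open>v \<noteq> y\<close> xy by (auto simp: in_toggle_iff)
      then show ?thesis using u False by blast
    qed
  qed
  then have "dominating V ?E (insert x (D - {y}))"
    using D xy unfolding dominating_def by auto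
  with real show ?thesis by blast
qed

text \<open>The descent step for the sum of indices in \<open>D\<close>. Only \<open>c < y\<close>
  matters there; \<open>c\<close> may differ from \<open>x\<close>, since a neighbor of
  \<open>y\<close> may serve instead.\<close>

lemma dominating_exchange:
  fixes V :: "'a::linorder set"
  assumes E: "realizes V d E" and D: "dominating V E D"
    and xy: "x \<in> V - D" "y \<in> D" "x < y"
    and anti: "antimono_on V d" and pos: "\<And>v. v \<in> V \<Longrightarrow> d v > 0"
  shows "\<exists>E' c. realizes V d E' \<and> c \<in> V - D \<and> c < y \<and> dominating V E' (insert c (D - {y}))"
proof -
  note symE = realizes_sym[OF E] and irrE = realizes_irrefl[OF E]
  have yV: "y \<in> V" using xy D unfolding dominating_def by auto
  have dle: "d b \<le> d a" if "a \<in> V" "b \<in> V" "a \<le> b" for a b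
    using anti that by (auto simp: monotone_on_def)
  show ?thesis
  proof (cases "(x, y) \<in> E \<or> (\<exists>c \<in> D. (x, c) \<in> E \<and> (y, c) \<in> E) \<or> E `` {y} - E `` {x} - {x} \<noteq> {}")
    case True
    have "d y \<le> d x" using dle xy yV by auto
    from dominating_swap[OF E D xy(1,2) this True] show ?thesis using xy by blast
  next
    case False
    then have nb: "\<And>c. (y, c) \<in> E \<Longrightarrow> (x, c) \<in> E \<and> c \<notin> D" and nxy: "(x, y) \<notin> E"
      using symE by blast+
    obtain w where w: "w \<in> D" "(x, w) \<in> E" using xy D unfolding dominating_def by blast
    txt \<open>
      Here D - {y} + {x} dominates everything except possibly y. Unless w is adjacent to all
      neighbors of y, switching at one of them makes x a neighbor of y; otherwise w takes over
      all neighbors of y, and y can be replaced by any of them.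
    \<close>
    have wy: "w \<noteq> y" "(y, w) \<notin> E" using w nxy nb by auto
    have "E `` {y} \<noteq> {}" using pos[OF yV] realizes_card[OF E yV] by auto
    then obtain c0 where c0: "(y, c0) \<in> E" by blast
    show ?thesis
    proof (cases "\<exists>c. (y, c) \<in> E \<and> (c, w) \<notin> E")
      case True
      then obtain c where c: "(y, c) \<in> E" "(c, w) \<notin> E" by blast
      have cD: "c \<notin> D" "(x, c) \<in> E" using nb c by auto
      \<comment> \<open>The edges xw and cy become xy and cw. By \<open>nb\<close> every neighbor of
        \<open>y\<close>, including \<open>c\<close>, is adjacent to \<open>x\<close> and so stays
        dominated.\<close>
      let ?E = "toggle {x, c} {y, w} E"
      have "realizes V d ?E"
        using c cD w wy nxy xy symE irrE by (intro realizes_two_switch[OF E]) auto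
      moreover have "\<exists>u \<in> insert x (D - {y}). (v, u) \<in> ?E"
        if v: "v \<in> V - insert x (D - {y})" for v
      proof (cases "v = y \<or> (y, v) \<in> E")
        case True
        then have "(v, x) \<in> ?E"
          using nb v w wy symE nxy c irrE by (auto simp: in_toggle_iff)
        then show ?thesis by blast
      next
        case False
        then obtain u where u: "u \<in> D" "(v, u) \<in> E" "u \<noteq> y"
          using v D symE unfolding dominating_def by blast
        moreover have "(v, u) \<in> ?E"
          using u v False c xy cD w by (auto simp: in_toggle_iff)
        ultimately show ?thesis by blast
      qed
      then have "dominating V ?E (insert x (D - {y}))"
        using D xy unfolding dominating_def by auto
      ultimately show ?thesis using xy by blast
    next
      case False
      have c0V: "c0 \<in> V - D" using c0 nb realizes_verts[OF E] by blast
      have dom: "dominating V E (insert c0 (D - {y}))"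
        unfolding dominating_def
      proof (intro conjI ballI)
        fix v assume v: "v \<in> V - insert c0 (D - {y})"
        show "\<exists>u \<in> insert c0 (D - {y}). (v, u) \<in> E"
        proof (cases "v = y")
          case True
          then show ?thesis using c0 by blast
        next
          case vy: False
          then obtain u where u: "u \<in> D" "(v, u) \<in> E" using v D unfolding dominating_def by blast
          show ?thesis
          proof (cases "u = y")
            case True
            then have "(v, w) \<in> E" using False u symE by blast
            then show ?thesis using w wy by blast
          next
            case False
            then show ?thesis using u by blast
          qed
        qed
      qed (use D c0V in \<open>auto simp: dominating_def\<close>)
      show ?thesis
      proof (cases "c0 < y")
        case True
        then show ?thesis using E dom c0V by blast
      next
        case False
        \<comment> \<open>If \<open>c0\<close> does not precede \<open>y\<close>, it is swapped for
          \<open>x\<close> in turn: \<open>x < y \<le> c0\<close> gives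
          \<open>d c0 \<le> d x\<close>, and \<open>x\<close> is adjacent to
          \<open>c0\<close>.\<close>
        have x: "x \<in> V - insert c0 (D - {y})" "(x, c0) \<in> E" using xy c0 nb irrE by auto
        obtain E' where "realizes V d E'"
          "dominating V E' (insert x (insert c0 (D - {y}) - {c0}))"
          using dominating_swap[OF E dom x(1), of c0] x dle[of x c0] xy c0V False by auto
        moreover have "insert x (insert c0 (D - {y}) - {c0}) = insert x (D - {y})"
          using c0V by auto
        ultimately show ?thesis using xy by auto
      qed
    qed
  qed
qed

section \<open>Switches across a bipartition\<close>

text \<open>The parts \<open>P\<close> and \<open>Q\<close> are kept abstract so that
  \<open>D\<close> and its complement can be taken in either role.\<close>

lemma cross_switch_exists:
  assumes E: "realizes V d E" and V: "V = P \<union> Q" "P \<inter> Q = {}"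
    and ij: "i \<in> P" "j \<in> P" "d j \<le> d i"
    and less: "card {w \<in> Q. (i, w) \<in> E} < card {w \<in> Q. (j, w) \<in> E}"
  obtains z t where "z \<in> Q" "(j, z) \<in> E" "(i, z) \<notin> E" "t \<in> P" "(i, t) \<in> E" "(j, t) \<notin> E" "t \<noteq> j"
proof -
  note symE = realizes_sym[OF E] and irrE = realizes_irrefl[OF E]
  have fin: "finite P" "finite Q" using E V by (auto simp: realizes_def)
  have "\<not> {w \<in> Q. (j, w) \<in> E} \<subseteq> {w \<in> Q. (i, w) \<in> E}"
    using less fin by (metis (no_types, lifting) card_mono finite_Collect_conjI finite_subset
        leD mem_Collect_eq subsetI)
  then obtain z where z: "z \<in> Q" "(j, z) \<in> E" "(i, z) \<notin> E" by blast
  have split: "d v = card {w \<in> P. (v, w) \<in> E} + card {w \<in> Q. (v, w) \<in> E}" if "v \<in> P" for v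
  proof -
    have "E `` {v} = {w \<in> P. (v, w) \<in> E} \<union> {w \<in> Q. (v, w) \<in> E}"
      using realizes_verts[OF E] V by auto
    then show ?thesis
      using realizes_card[OF E, of v] that V fin
      by (subst card_Un_disjoint[symmetric]) auto
  qed
  have "card {w \<in> P. (j, w) \<in> E} < card {w \<in> P. (i, w) \<in> E}"
    using split[OF ij(1)] split[OF ij(2)] ij(3) less by linarith
  \<comment> \<open>An edge between \<open>i\<close> and \<open>j\<close> counts once on each side;
    discarding it keeps the inequality strict and ensures \<open>t \<noteq> j\<close>.\<close>
  then have "card ({w \<in> P. (j, w) \<in> E} - {i}) < card ({w \<in> P. (i, w) \<in> E} - {j})"
    using ij symE[of i j] fin
    by (cases "(i, j) \<in> E") (auto simp: card_Diff_singleton_if card_gt_0_iff intro!: diff_less_mono Suc_leI)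
  then have "\<not> {w \<in> P. (i, w) \<in> E} - {j} \<subseteq> {w \<in> P. (j, w) \<in> E} - {i}"
    using fin by (auto dest!: card_mono[rotated])
  then show ?thesis using that z irrE by blast
qed

section \<open>Translation between edge relations and graphs\<close>

lemma out_degree_eq_card_Image:
  "degree G v = card (parcs G `` {v})"
proof -
  have "out_arcs (with_proj G) v = Pair v ` (parcs G `` {v})"
    by (auto simp: out_arcs_def)
  then show ?thesis by (simp add: out_degree_def card_image inj_on_def)
qed

lemma realizes_imp_realization_by:
  assumes "realizes {1..n} d E"
  shows "realization_by n d \<lparr>pverts = {1..n}, parcs = E\<rparr> id"
proof -
  have "finite E" using assms finite_subset[of E "{1..n} \<times> {1..n}"] by (simp add: realizes_def)
  moreover have "arcs_ends (with_proj \<lparr>pverts = {1..n}, parcs = E\<rparr>) = E"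
    by (auto simp: arcs_ends_def arc_to_ends_def)
  ultimately have "pair_graph \<lparr>pverts = {1..n}, parcs = E\<rparr>"
    using realizes_verts[OF assms] realizes_irrefl[OF assms] assms
    by unfold_locales (auto simp: realizes_def symmetric_def)
  then show ?thesis
    using assms by (simp add: realization_by_def out_degree_eq_card_Image realizes_def)
qed

text \<open>Pulling \<open>G\<close> and \<open>D\<close> back along \<open>u\<close> identifies
  each vertex with its index, so that the order of the degree sequence becomes an order on the
  vertices.\<close>

lemma realization_by_imp_realizes:
  assumes "realization_by n d G u" and D: "dominating_set G D"
  obtains E D' where "realizes {1..n} d E" "dominating {1..n} E D'" "card D' = card D"
proof -
  interpret pair_graph G using assms by (simp add: realization_by_def)
  have bij: "bij_betw u {1..n} (pverts G)" and deg: "\<And>i. i \<in> {1..n} \<Longrightarrow> degree G (u i) = d i"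
    using assms by (auto simp: realization_by_def)
  have inj: "inj_on u {1..n}" and img: "u ` {1..n} = pverts G"
    using bij by (auto simp: bij_betw_def)
  let ?E = "{(i, j). i \<in> {1..n} \<and> j \<in> {1..n} \<and> (u i, u j) \<in> parcs G}"
  let ?D = "{i \<in> {1..n}. u i \<in> D}"
  have pv: "(a, b) \<in> parcs G \<Longrightarrow> a \<in> pverts G \<and> b \<in> pverts G" for a b
    using in_arcsD1 in_arcsD2 by blast
  have "card (?E `` {i}) = d i" if i: "i \<in> {1..n}" for i
  proof -
    have "u ` (?E `` {i}) = parcs G `` {u i}"
      using i img pv by (auto simp: image_iff) (metis image_iff atLeastAtMost_iff)
    moreover have "inj_on u (?E `` {i})" using inj by (rule inj_on_subset) auto
    ultimately have "card (?E `` {i}) = card (parcs G `` {u i})"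
      using card_image by fastforce
    then show ?thesis
      using deg[OF i] by (simp add: out_degree_eq_card_Image)
  qed
  moreover have "sym ?E"
    by (auto intro!: symI intro: arcs_symmetric)
  moreover have "irrefl ?E"
    using no_loops' by (intro irreflI) blast
  ultimately have "realizes {1..n} d ?E" by (auto simp: realizes_def)
  moreover have "dominating {1..n} ?E ?D"
    unfolding dominating_def
  proof (intro conjI ballI)
    fix v assume v: "v \<in> {1..n} - ?D"
    then have "u v \<in> pverts G - D" using img by blast
    then obtain w where "w \<in> D" "(u v, w) \<in> parcs G"
      using D unfolding dominating_set_def by blast
    then obtain j where "j \<in> {1..n}" "u j \<in> D" "(u v, u j) \<in> parcs G"
      using pv img by (metis imageE)
    then show "\<exists>w \<in> ?D. (v, w) \<in> ?E" using v by auto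
  qed auto
  moreover have "D \<subseteq> u ` {1..n}" using D img by (simp add: dominating_set_def)
  then have "u ` ?D = D" by blast
  then have "card ?D = card D"
    using inj by (metis (no_types, lifting) card_image inj_on_subset mem_Collect_eq subsetI)
  ultimately show ?thesis using that by blast
qed

section \<open>Domination numbers as attained minima\<close>

lemma domination_number_le: "dominating_set G D \<Longrightarrow> domination_number G \<le> card D"
  unfolding domination_number_def by (rule Least_le) blast

lemma domination_number_attained:
  obtains D where "dominating_set G D" "card D = domination_number G"
proof -
  \<comment> \<open>The full vertex set dominates, so the \<open>LEAST\<close> ranges over a
    nonempty set.\<close>
  have "dominating_set G (pverts G)" by (simp add: dominating_set_def)
  then have "\<exists>m D. dominating_set G D \<and> card D = m" by blast
  then have "\<exists>D. dominating_set G D \<and> card D = domination_number G"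
    unfolding domination_number_def by (rule LeastI_ex)
  then show ?thesis using that by blast
qed

lemma gamma_min_le:
  assumes "realizes {1..n} d E" "dominating {1..n} E D"
  shows "gamma_min n d \<le> card D"
proof -
  let ?G = "\<lparr>pverts = {1..n}, parcs = E\<rparr>"
  have "?G \<in> realizations n d"
    using realizes_imp_realization_by[OF assms(1)] by (auto simp: realizations_def)
  then have "gamma_min n d \<le> domination_number ?G"
    unfolding gamma_min_def by (intro Least_le) blast
  also have "\<dots> \<le> card D"
    using assms by (intro domination_number_le) (simp add: dominating_def dominating_set_def)
  finally show ?thesis .
qed

lemma gamma_min_attained:
  assumes "graphic n d"
  obtains E D where "realizes {1..n} d E" "dominating {1..n} E D" "card D = gamma_min n d"
proof -
  have "\<exists>m. \<exists>G \<in> realizations n d. domination_number G = m"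
    using assms by (auto simp: graphic_def)
  then have "\<exists>G \<in> realizations n d. domination_number G = gamma_min n d"
    unfolding gamma_min_def by (rule LeastI_ex)
  then obtain G :: "nat pair_pre_digraph" and u where G: "realization_by n d G u" "domination_number G = gamma_min n d"
    by (auto simp: realizations_def)
  obtain D where "dominating_set G D" "card D = domination_number G"
    by (rule domination_number_attained)
  then show ?thesis using realization_by_imp_realizes[OF G(1)] G(2) that by metis
qed

section \<open>Complements and initial segments as dominating sets\<close>

text \<open>A vertex \<open>v\<close> of \<open>D\<close> with no neighbor outside \<open>D\<close>
  has one inside, as \<open>d v > 0\<close>. Then \<open>D - {v}\<close> still dominates, since no
  outside vertex relied on \<open>v\<close>, against minimality.\<close>

lemma complement_dominating:
  assumes E: "realizes V d E" and D: "dominating V E D"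
    and pos: "\<And>v. v \<in> V \<Longrightarrow> d v > 0"
    and min: "\<And>D'. dominating V E D' \<Longrightarrow> card D \<le> card D'"
  shows "dominating V E (V - D)"
proof (rule ccontr)
  assume "\<not> dominating V E (V - D)"
  then obtain v where v: "v \<in> D" "v \<in> V" "\<And>w. w \<in> V - D \<Longrightarrow> (v, w) \<notin> E"
    using D unfolding dominating_def by blast
  have "E `` {v} \<noteq> {}" using pos[OF v(2)] realizes_card[OF E v(2)] by auto
  then obtain w where "(v, w) \<in> E" by blast
  then have w: "(v, w) \<in> E" "w \<in> D - {v}"
    using v realizes_verts[OF E] realizes_irrefl[OF E] by auto
  have "dominating V E (D - {v})"
    using D v w realizes_sym[OF E] unfolding dominating_def by blast
  from min[OF this] have "card D \<le> card (D - {v})" .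
  moreover have "finite D" using D E finite_subset by (auto simp: dominating_def realizes_def)
  ultimately show False using v by (metis card_Diff1_less leD)
qed

lemma initial_dominating_set:
  assumes anti: "antimono_on {1..n} d" and pos: "\<And>v. v \<in> {1..n} \<Longrightarrow> d v > 0"
    and "graphic n d"
  obtains E where "realizes {1..n} d E" "dominating {1..n} E {1..gamma_min n d}"
proof -
  let ?P = "\<lambda>(E, D). realizes {1..n} d E \<and> dominating {1..n} E D \<and> card D = gamma_min n d"
  obtain E1 D1 where "realizes {1..n} d E1" "dominating {1..n} E1 D1" "card D1 = gamma_min n d"
    by (rule gamma_min_attained[OF assms(3)])
  then have "?P (E1, D1)" by simp
  \<comment> \<open>Realization and dominating set are minimized together, because an exchange
    changes both.\<close>
  then obtain p where "?P p" and min': "\<And>q. ?P q \<Longrightarrow> \<Sum>(snd p) \<le> \<Sum>(snd q)"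
    using ex_has_least_nat[of ?P "(E1, D1)" "\<lambda>p. \<Sum>(snd p)"] by blast
  then obtain E D where E: "realizes {1..n} d E" and D: "dominating {1..n} E D"
    and card: "card D = gamma_min n d" and p: "p = (E, D)" by (cases p) auto
  note min = min'[unfolded p, simplified]
  have sub: "D \<subseteq> {1..n}" using D by (simp add: dominating_def)
  then have fin: "finite D" using finite_subset by blast
  have "D = {1..gamma_min n d}"
  proof (rule ccontr)
    assume neq: "D \<noteq> {1..gamma_min n d}"
    \<comment> \<open>Both sets have \<open>gamma_min n d\<close> elements, so being different they
      are incomparable; this yields \<open>x \<le> gamma_min n d < y\<close>.\<close>
    then have "\<not> {1..gamma_min n d} \<subseteq> D" "\<not> D \<subseteq> {1..gamma_min n d}"
      using card fin card_subset_eq by (metis card_atLeastAtMost diff_Suc_1 finite_atLeastAtMost)+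
    then obtain x y where x: "x \<notin> D" "x \<in> {1..gamma_min n d}"
      and y: "y \<in> D" "y \<notin> {1..gamma_min n d}" by blast
    then have xy: "x < y" "x \<in> {1..n} - D" using sub by auto
    from dominating_exchange[OF E D xy(2) y(1) xy(1) anti pos]
    obtain E' c where E': "realizes {1..n} d E'" "dominating {1..n} E' (insert c (D - {y}))"
      and c: "c \<in> {1..n} - D" "c < y" by blast
    have "card (insert c (D - {y})) = gamma_min n d"
      using c y card fin card_Suc_Diff1 by fastforce
    then have "\<Sum>D \<le> \<Sum>(insert c (D - {y}))" using min[of "(E', insert c (D - {y}))"] E' by simp
    moreover have "\<Sum>(insert c (D - {y})) = c + \<Sum>(D - {y})" using c fin by simp
    moreover have "\<Sum>D = y + \<Sum>(D - {y})" using y fin by (simp add: sum.remove)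
    ultimately show False using c by linarith
  qed
  then show ?thesis using E D that by simp
qed

section \<open>Ordering the degrees across the partition\<close>

theorem theorem1:
  fixes n k :: nat and d :: "nat \<Rightarrow> nat"
  assumes "n \<ge> 1"
    and "antimono_on {1..n} d"
    and "graphic n d"
    and "d n \<ge> 1"
    and "gamma_min n d = k"
  shows "\<exists>(G :: nat pair_pre_digraph) u.
    pair_graph G \<and>
    inj_on u {1..n} \<and> pverts G = u ` {1..n} \<and>
    (\<forall>i \<in> {1..n}. degree G (u i) = d i) \<and>
    (let D = u ` {1..k}; D' = u ` {k+1..n} in
       dominating_set G D \<and> dominating_set G D' \<and>
       antimono_on {1..k} (\<lambda>i. degree_in G D' (u i)) \<and>
       antimono_on {k+1..n} (\<lambda>i. degree_in G D (u i)))"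
proof -
  let ?V = "{1..n}" let ?P = "{1..k}" let ?Q = "{k+1..n}"
  have dle: "d j \<le> d i" if "i \<in> ?V" "j \<in> ?V" "i \<le> j" for i j
    using assms(2) that by (auto simp: monotone_on_def)
  have pos: "d v > 0" if "v \<in> ?V" for v
    using dle[of v n] that assms by auto
  obtain E0 where E0: "realizes ?V d E0" "dominating ?V E0 ?P"
    using initial_dominating_set[OF assms(2) pos assms(3)] assms(5) by auto
  \<comment> \<open>\<open>E\<close> holds both orientations of each edge; restricting to
    \<open>?P \<times> ?Q\<close> counts every cross edge once.\<close>
  define weight :: "(nat \<times> nat) set \<Rightarrow> nat" where
    "weight E = (\<Sum>(a, b) \<in> E \<inter> ?P \<times> ?Q. a + b)" for E
  obtain E where E: "realizes ?V d E" "dominating ?V E ?P"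
    and min: "\<And>E'. realizes ?V d E' \<Longrightarrow> dominating ?V E' ?P \<Longrightarrow> weight E \<le> weight E'"
    using ex_has_least_nat[of "\<lambda>E. realizes ?V d E \<and> dominating ?V E ?P" E0 weight] E0 by metis
  note symE = realizes_sym[OF E(1)] and irrE = realizes_irrefl[OF E(1)]
  have kn: "?P \<subseteq> ?V" using E by (simp add: dominating_def)
  have VPQ: "?V = ?P \<union> ?Q" "?P \<inter> ?Q = {}" "?V - ?P = ?Q" using kn by auto
  have QP: "?V = ?Q \<union> ?P" "?Q \<inter> ?P = {}" using VPQ by auto
  \<comment> \<open>Since \<open>k\<close> is the minimum over all realizations, no dominating set
    of \<open>E\<close> is smaller than \<open>?P\<close>.\<close>
  have domQ: "dominating ?V E ?Q"
    using complement_dominating[OF E pos] gamma_min_le[OF E(1)] assms(5) VPQ by simp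
  \<comment> \<open>In both uses the two traded cross edges share the endpoint \<open>z\<close>, so
    the drop in weight comes from \<open>i < j\<close>.\<close>
  have weight_less: "weight E' < weight E"
    if "E' \<inter> ?P \<times> ?Q = insert (a', b') (E \<inter> ?P \<times> ?Q - {(a, b)})"
      "(a, b) \<in> E \<inter> ?P \<times> ?Q" "(a', b') \<notin> E" "a' + b' < a + b" for E' a b a' b'
  proof -
    have fin: "finite (E \<inter> ?P \<times> ?Q)" by simp
    have "weight E' = a' + b' + (\<Sum>(a, b) \<in> E \<inter> ?P \<times> ?Q - {(a, b)}. a + b)"
      unfolding weight_def that(1) using that(3) by (subst sum.insert) auto
    moreover have "weight E = a + b + (\<Sum>(a, b) \<in> E \<inter> ?P \<times> ?Q - {(a, b)}. a + b)"
      unfolding weight_def using that(2) fin by (subst sum.remove) auto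
    ultimately show ?thesis using that(4) by simp
  qed
  have antiP: "card {w \<in> ?Q. (j, w) \<in> E} \<le> card {w \<in> ?Q. (i, w) \<in> E}"
    if ij: "i \<in> ?P" "j \<in> ?P" "i < j" for i j
  proof (rule ccontr)
    assume "\<not> ?thesis"
    then have less: "card {w \<in> ?Q. (i, w) \<in> E} < card {w \<in> ?Q. (j, w) \<in> E}" by simp
    have "d j \<le> d i" using dle ij kn by (meson less_imp_le subsetD)
    from cross_switch_exists[OF E(1) VPQ(1,2) ij(1,2) this less]
    obtain z t where z: "z \<in> ?Q" "(j, z) \<in> E" "(i, z) \<notin> E"
      and t: "t \<in> ?P" "(i, t) \<in> E" "(j, t) \<notin> E" "t \<noteq> j" by blast
    let ?E = "toggle {i, j} {z, t} E"
    have zt: "z \<notin> ?P" "t \<notin> ?Q" "z \<noteq> t" "i \<notin> ?Q" "j \<notin> ?Q" using z t ij by auto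
    have "realizes ?V d ?E"
      using z t ij zt by (intro realizes_two_switch[OF E(1)]) auto
    moreover have "dominating ?V ?E ?P"
      unfolding dominating_def
    proof (intro conjI ballI kn)
      fix v assume v: "v \<in> ?V - ?P"
      then obtain w where w: "w \<in> ?P" "(v, w) \<in> E" using E(2) unfolding dominating_def by blast
      \<comment> \<open>Outside \<open>?P\<close> only \<open>z\<close> is affected: it loses
        \<open>j\<close> but gains \<open>i\<close>. The other two toggled pairs lie inside
        \<open>?P\<close>.\<close>
      show "\<exists>w \<in> ?P. (v, w) \<in> ?E"
      proof (cases "v = z")
        case True
        have "(z, i) \<in> ?E" using z symE zt ij t by (auto simp: in_toggle_iff)
        then show ?thesis using True ij by blast
      next
        case False
        have "(v, w) \<in> ?E" using w v False ij t by (auto simp: in_toggle_iff)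
        then show ?thesis using w by blast
      qed
    qed
    moreover have "?E \<inter> ?P \<times> ?Q = insert (i, z) (E \<inter> ?P \<times> ?Q - {(j, z)})"
      using z t ij zt unfolding toggle_def by (simp only: set_eq_iff) (auto simp del: atLeastAtMost_iff)
    then have "weight ?E < weight E"
      by (rule weight_less) (use z ij in auto)
    ultimately show False using min by (meson leD)
  qed
  have antiQ: "card {w \<in> ?P. (j, w) \<in> E} \<le> card {w \<in> ?P. (i, w) \<in> E}"
    if ij: "i \<in> ?Q" "j \<in> ?Q" "i < j" for i j
  proof (rule ccontr)
    assume "\<not> ?thesis"
    then have less: "card {w \<in> ?P. (i, w) \<in> E} < card {w \<in> ?P. (j, w) \<in> E}" by simp
    have "d j \<le> d i" using dle ij by auto
    from cross_switch_exists[OF E(1) QP ij(1,2) this less]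
    obtain z t where z: "z \<in> ?P" "(j, z) \<in> E" "(i, z) \<notin> E"
      and t: "t \<in> ?Q" "(i, t) \<in> E" "(j, t) \<notin> E" "t \<noteq> j" by blast
    let ?E = "toggle {i, j} {z, t} E"
    have zt: "z \<notin> ?Q" "t \<notin> ?P" "z \<noteq> t" "i \<notin> ?P" "j \<notin> ?P" using z t ij by auto
    \<comment> \<open>As \<open>j\<close> is about to lose \<open>z\<close>, it needs a second
      neighbor in \<open>?P\<close>: \<open>i\<close> is dominated and \<open>j\<close> has more
      neighbors in \<open>?P\<close> than \<open>i\<close>, hence at least two.\<close>
    have "i \<in> ?V - ?P" using ij by auto
    then obtain s where s: "s \<in> ?P" "(i, s) \<in> E" using E(2) unfolding dominating_def by blast
    obtain r where r: "r \<in> ?P" "(j, r) \<in> E" "r \<noteq> z"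
    proof -
      have "card {w \<in> ?P. (i, w) \<in> E} > 0" using s by (auto simp: card_gt_0_iff)
      then have "card {w \<in> ?P. (j, w) \<in> E} > 1" using less by linarith
      then have "\<not> {w \<in> ?P. (j, w) \<in> E} \<subseteq> {z}"
        by (metis card_mono finite.intros card.empty card_insert_disjoint empty_iff leD One_nat_def)
      then show ?thesis using that by blast
    qed
    have "realizes ?V d ?E"
      using z t ij zt by (intro realizes_two_switch[OF E(1)]) auto
    moreover have "dominating ?V ?E ?P"
      unfolding dominating_def
    proof (intro conjI ballI kn)
      fix v assume v: "v \<in> ?V - ?P"
      then obtain w where w: "w \<in> ?P" "(v, w) \<in> E" using E(2) unfolding dominating_def by blast
      show "\<exists>w \<in> ?P. (v, w) \<in> ?E"
      proof (cases "v = j")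
        case True
        have "(j, r) \<in> ?E" using r zt ij t by (auto simp: in_toggle_iff)
        then show ?thesis using True r by blast
      next
        case False
        have "(v, w) \<in> ?E" using w v False z zt by (auto simp: in_toggle_iff)
        then show ?thesis using w by blast
      qed
    qed
    \<comment> \<open>The weight reads cross pairs from \<open>?P\<close> to \<open>?Q\<close>, so
      the edges at \<open>z\<close> now appear as \<open>(z, i)\<close> and
      \<open>(z, j)\<close>.\<close>
    moreover have "?E \<inter> ?P \<times> ?Q = insert (z, i) (E \<inter> ?P \<times> ?Q - {(z, j)})"
      using z t ij zt symE unfolding toggle_def by (simp only: set_eq_iff) (auto simp del: atLeastAtMost_iff)
    then have "weight ?E < weight E"
      by (rule weight_less) (use z ij symE[of z] in auto)
    ultimately show False using min by (meson leD)
  qed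
  let ?G = "\<lparr>pverts = ?V, parcs = E\<rparr>"
  have "realization_by n d ?G id" by (rule realizes_imp_realization_by[OF E(1)])
  then have "pair_graph ?G" "\<forall>i \<in> ?V. degree ?G (id i) = d i"
    unfolding realization_by_def by blast+
  moreover have "dominating_set ?G ?P" "dominating_set ?G ?Q"
    using E(2) domQ by (auto simp: dominating_def dominating_set_def)
  moreover have "antimono_on ?P (\<lambda>i. degree_in ?G ?Q i)"
    using antiP by (auto simp: monotone_on_def degree_in_def le_less)
  moreover have "antimono_on ?Q (\<lambda>i. degree_in ?G ?P i)"
    using antiQ by (auto simp: monotone_on_def degree_in_def le_less)
  ultimately show ?thesis
    by (intro exI[of _ ?G] exI[of _ id]) (simp add: Let_def)
qed

end
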